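(* Let $A=(a_{i,j})_{1\le i\le m,\,1\le j\le n}$ be an $m\times n$ matrix over a commutative ring with unity, with $m\le n$, and let $1\le k\le m-1$. Then $$R(x;z;A)=\sum_{\substack{S\subseteq N_m\setminus N_{m-k}\\ S\neq\emptyset}}\ \sum_{\varphi\in \mathrm{Inj}(S,N_n)} z^{|\varphi|}\Big(\prod_{i\in S}a_{i,\varphi(i)}\Big)\,R\big(x;z;A[N_{m-k}\,|\,\bar\varphi(N_n)]\big)\,x^{|S|}\;+\;R\big(x;z;A[N_{m-k}\,|\,N_n]\big).$$
   Context: $N_n=\{1,\dots,n\}$. For $S\subseteq N_n$, $\mathrm{Inj}(S,N_n)$ is the set of injective maps $S\to N_n$. For $\varphi\in\mathrm{Inj}(S,N_n)$, $|\varphi|$ denotes the number of cycles of $\varphi$, i.e. the number of nonempty sets $C\subseteq S$ of the form $C=\{j,\varphi(j),\dots,\varphi^{p-1}(j)\}$ with $\varphi^p(j)=j$. For an $m\times n$ matrix $A=(a_{i,j})$ with $m\le n$: $r_l(z;A)=\sum_{S\subseteq N_m,|S|=l}\sum_{\varphi\in\mathrm{Inj}(S,N_n)}z^{|\varphi|}\prod_{i\in S}a_{i,\varphi(i)}$ (so $r_0(z;A)=1$), and the cyclic rook polynomial is $R(x;z;A)=\sum_{l=0}^m r_l(z;A)x^l$ (equal to $1$ for a matrix with no rows). For a set of row indices $T$ (taken in increasing order) and a sequence of column indices $(c_1,\dots,c_q)$, $A[T\,|\,c_1,\dots,c_q]$ is the matrix whose rows are the rows of $A$ indexed by $T$ in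 increasing order and whose $s$-th column is column $c_s$ of $A$ (restricted to those rows); it is then re-indexed by $1,2,\dots$ in rows and columns, and $R(x;z;\cdot)$ is computed with respect to this new indexing. $A[T|N_n]$ means columns $1,\dots,n$ in order. For $S\subseteq N_n$ and $\varphi\in\mathrm{Inj}(S,N_n)$, define the bijection $\varphi^*:\varphi(S)\setminus S\to S\setminus\varphi(S)$: for $j\in\varphi(S)\setminus S$, put $j_0=j$, $j_l=\varphi^{-1}(j_{l-1})$ as long as $j_{l-1}\in\varphi(S)$, and $\varphi^*(j)=j_m$ where $j_m$ is the first term lying in $S\setminus\varphi(S)$. For a sequence $(x_1,\dots,x_n)$, $\bar\varphi(x_1,\dots,x_n)$ is the sequence $(y_j)_{j\in N_n\setminus S}$ (in increasing order of $j$) with $y_j=x_j$ if $j\notin\varphi(S)$ and $y_j=x_{\varphi^*(j)}$ if $j\in\varphi(S)\setminus S$; $\bar\varphi(N_n)$ denotes $\bar\varphi(1,2,\dots,n)$. *)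

theory Defs
  imports
    "HOL-Library.FuncSet"
    "HOL-Computational_Algebra.Polynomial"
    "Jordan_Normal_Form.Matrix"
begin

text \<open>
  Rows and columns are indexed from 0, following the convention of the matrix library, so the
  index set usually written \<open>{1, ..., n}\<close> is rendered as \<open>{..<n}\<close>. The shift is applied to rows
  and columns alike; hence cycles, which identify row indices with column indices, are unaffected.
\<close>

definition Inj :: "nat set \<Rightarrow> nat set \<Rightarrow> (nat \<Rightarrow> nat) set"
  where "Inj S T = {\<phi> \<in> S \<rightarrow>\<^sub>E T. inj_on \<phi> S}"

text \<open>
  As \<open>C \<subseteq> S\<close>, the iterates below only ever apply \<open>\<phi>\<close> to elements of its domain \<open>S\<close>.
\<close>

definition num_cycles :: "nat set \<Rightarrow> (nat \<Rightarrow> nat) \<Rightarrow> nat"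
  where "num_cycles S \<phi> =
    card {C. C \<noteq> {} \<and> C \<subseteq> S \<and> (\<exists>j p. C = (\<lambda>i. (\<phi> ^^ i) j) ` {..<p} \<and> (\<phi> ^^ p) j = j)}"

text \<open>
  Polynomials in \<open>z\<close> have type \<open>'a poly\<close>, and polynomials in \<open>x\<close> and \<open>z\<close> have type
  \<open>'a poly poly\<close>, with \<open>x\<close> the outer and \<open>z\<close> the inner indeterminate; thus
  \<open>monom (monom c i) l\<close> stands for \<open>c z\<^sup>i x\<^sup>l\<close>.
\<close>

definition cyclic_rook_number :: "nat \<Rightarrow> 'a::comm_ring_1 mat \<Rightarrow> 'a poly"
  where "cyclic_rook_number l A =
    (\<Sum>S | S \<subseteq> {..<dim_row A} \<and> card S = l. \<Sum>\<phi>\<in>Inj S {..<dim_col A}.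
       monom (\<Prod>i\<in>S. A $$ (i, \<phi> i)) (num_cycles S \<phi>))"

definition cyclic_rook_poly :: "'a::comm_ring_1 mat \<Rightarrow> 'a poly poly"
  where "cyclic_rook_poly A = (\<Sum>l\<le>dim_row A. monom (cyclic_rook_number l A) l)"

text \<open>The matrix \<open>A[T | c\<^sub>1, ..., c\<^sub>q]\<close>, re-indexed in rows and columns.\<close>

definition rows_cols :: "'a mat \<Rightarrow> nat set \<Rightarrow> nat list \<Rightarrow> 'a mat"
  where "rows_cols A T cs =
    mat (card T) (length cs) (\<lambda>(i, j). A $$ (sorted_list_of_set T ! i, cs ! j))"

text \<open>
  For \<open>j \<in> \<phi> ` S - S\<close> the terms preceding the first one in \<open>S - \<phi> ` S\<close> all lie in \<open>\<phi> ` S\<close>, so the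
  inverse of \<open>\<phi>\<close> is only applied where it is defined.
\<close>

definition phi_star :: "nat set \<Rightarrow> (nat \<Rightarrow> nat) \<Rightarrow> nat \<Rightarrow> nat"
  where "phi_star S \<phi> j =
    (inv_into S \<phi> ^^ (LEAST l. (inv_into S \<phi> ^^ l) j \<in> S - \<phi> ` S)) j"

definition phi_bar :: "nat set \<Rightarrow> (nat \<Rightarrow> nat) \<Rightarrow> 'b list \<Rightarrow> 'b list"
  where "phi_bar S \<phi> xs =
    map (\<lambda>j. if j \<in> \<phi> ` S then xs ! phi_star S \<phi> j else xs ! j)
      (sorted_list_of_set ({..<length xs} - S))"

end

(*
  A partial injection Phi on S \<union> T, where T consists of the retained rows and S of the deleted ones,
  is determined by phi = Phi|S and by the columns of N - phi(S) into which Phi maps T. The column map j -> phi^*(j)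
  (or j, if j is not in phi(S)) is a bijection from N - S onto N - phi(S), and phi leads from each of
  its values back to its label j. Relabelling the columns therefore contracts the S-segments of the
  cycles of Phi: a cycle of Phi either lies in S and is a cycle of phi, or it becomes a cycle of the
  contracted map on T. So the numbers of cycles add up, and the expansion follows by splitting
  the sum over Phi.
*)

theory Submission
  imports Defs
begin

section \<open>Cycles of a relation\<close>

text \<open>Intended for single-valued \<open>r\<close>, where the set reached from a recurrent
  point is exactly the cycle through it. Relations, unlike functions, let two maps with disjoint
  domains be combined by a plain union.\<close>

definition cycles :: "('a \<times> 'a) set \<Rightarrow> 'a set set"
  where "cycles r = {r\<^sup>+ `` {x} | x. (x, x) \<in> r\<^sup>+}"

definition graph :: "'a set \<Rightarrow> ('a \<Rightarrow> 'b) \<Rightarrow> ('a \<times> 'b) set"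
  where "graph S f = (\<lambda>i. (i, f i)) ` S"

lemma single_valued_graph: "single_valued (graph S f)"
  by (auto simp: single_valued_def graph_def)

text \<open>In a single-valued relation the path out of \<open>x\<close> is forced, so whatever it
  meets lies on the closed path through \<open>x\<close>.\<close>

lemma cyclic_reaches_back:
  assumes "single_valued r" "(x, x) \<in> r\<^sup>+" "(x, y) \<in> r\<^sup>+"
  shows "(y, x) \<in> r\<^sup>+"
  using assms(3)
proof (induction rule: trancl_induct)
  case (base y)
  from assms(2) obtain z where "(x, z) \<in> r" "(z, x) \<in> r\<^sup>*"
    by (meson tranclD)
  with base assms(1) have "(y, x) \<in> r\<^sup>*" by (metis single_valuedD)
  \<comment> \<open>The rest of the path may be empty; appending the loop at \<open>x\<close> makes
    it nonempty.\<close>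
  then show ?case using assms(2) by (meson rtrancl_trancl_trancl)
next
  case (step y z)
  from step.IH obtain w where "(y, w) \<in> r" "(w, x) \<in> r\<^sup>*"
    by (meson tranclD)
  with step assms(1) have "(z, x) \<in> r\<^sup>*" by (metis single_valuedD)
  then show ?case using assms(2) by (meson rtrancl_trancl_trancl)
qed

text \<open>Any element can serve as the base point of a cycle. Consequently two cycles with a
  common point coincide.\<close>

lemma cycles_eq_Image:
  assumes "single_valued r" "C \<in> cycles r" "x \<in> C"
  shows "C = r\<^sup>+ `` {x}" and "(x, x) \<in> r\<^sup>+"
proof -
  obtain y where y: "C = r\<^sup>+ `` {y}" "(y, y) \<in> r\<^sup>+"
    using assms(2) by (auto simp: cycles_def)
  then have xy: "(y, x) \<in> r\<^sup>+" using assms(3) by auto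
  then have yx: "(x, y) \<in> r\<^sup>+" using cyclic_reaches_back assms(1) y(2) by metis
  show "C = r\<^sup>+ `` {x}" "(x, x) \<in> r\<^sup>+" using xy yx y(1) by (auto intro: trancl_trans)
qed

lemma cycles_subset_Domain:
  assumes "single_valued r" "C \<in> cycles r"
  shows "C \<subseteq> Domain r"
proof
  fix x assume "x \<in> C"
  then have "(x, x) \<in> r\<^sup>+" using cycles_eq_Image[OF assms] by blast
  then show "x \<in> Domain r" by (meson Domain.intros tranclD)
qed

text \<open>An edge ending outside \<open>Domain r\<close> runs into a dead end, so no cycle uses
  it.\<close>

lemma cycles_Int_Domain:
  assumes "single_valued r"
  shows "cycles r = cycles (r \<inter> UNIV \<times> Domain r)"
proof -
  let ?s = "r \<inter> UNIV \<times> Domain r"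
  have le: "(x, y) \<in> ?s\<^sup>+ \<Longrightarrow> (x, y) \<in> r\<^sup>+" for x y
    by (erule trancl_mono) auto
  have ge: "(x, y) \<in> r\<^sup>+ \<Longrightarrow> y \<in> Domain r \<Longrightarrow> (x, y) \<in> ?s\<^sup>+" for x y
  proof (induction rule: trancl_induct)
    case (step y z)
    then have "(x, y) \<in> ?s\<^sup>+" "(y, z) \<in> ?s" by auto
    then show ?case by (rule trancl_into_trancl)
  qed auto
  have dom: "(x, y) \<in> r\<^sup>+ \<Longrightarrow> x \<in> Domain r" for x y
    by (meson Domain.intros tranclD)
  have cyc: "(x, x) \<in> r\<^sup>+ \<longleftrightarrow> (x, x) \<in> ?s\<^sup>+" for x
    using le ge dom by blast
  \<comment> \<open>Every point reached from a recurrent point reaches back, hence has an outgoing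
    edge and lies in \<open>Domain r\<close>.\<close>
  have "r\<^sup>+ `` {x} = ?s\<^sup>+ `` {x}" if "(x, x) \<in> r\<^sup>+" for x
    using le ge dom cyclic_reaches_back[OF assms that] by blast
  then show ?thesis unfolding cycles_def using cyc by blast
qed

text \<open>
  Each edge of \<open>q\<close> contracts an edge of \<open>t\<close> followed by a maximal path of \<open>s\<close>, so a cycle of
  \<open>s \<union> t\<close> either stays in \<open>s\<close> or meets \<open>Domain t\<close> in a cycle of \<open>q\<close>.
\<close>

lemma card_cycles_contract:
  assumes sv: "single_valued (s \<union> t)" and svq: "single_valued q"
    and fin: "finite (Domain (s \<union> t))"
    and disj: "Domain s \<inter> Domain t = {}"
    and dom: "Domain q = Domain t"
    and contract: "\<And>x y. (x, y) \<in> t \<Longrightarrow> \<exists>w. (x, w) \<in> q \<and> (y, w) \<in> s\<^sup>* \<and> w \<notin> Domain s"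
  shows "card (cycles (s \<union> t)) = card (cycles s) + card (cycles q)"
proof -
  let ?r = "s \<union> t" and ?D = "Domain t"
  have svs: "single_valued s" using sv by (meson Un_upper1 single_valued_subset)
  \<comment> \<open>Invariant along the path: \<open>y\<close> sits on an \<open>s\<close>-segment
    whose final point \<open>w\<close> has already been reached by the contracted path in
    \<open>q\<close>.\<close>
  have fwd: "\<exists>w. (x, w) \<in> q\<^sup>+ \<and> (y, w) \<in> s\<^sup>* \<and> w \<notin> Domain s"
    if "(x, y) \<in> ?r\<^sup>+" "x \<in> ?D" for x y
    using that
  proof (induction rule: trancl_induct)
    case (base y)
    then have "(x, y) \<in> t" using disj by auto
    then show ?case using contract by blast
  next
    case (step y z)
    then obtain w where w: "(x, w) \<in> q\<^sup>+" "(y, w) \<in> s\<^sup>*" "w \<notin> Domain s" by blast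
    show ?case
    proof (cases "(y, z) \<in> s")
      case True
      then have "y \<noteq> w" using w(3) by auto
      then obtain z' where "(y, z') \<in> s" "(z', w) \<in> s\<^sup>*" using w(2) by (meson converse_rtranclE)
      with True svs have "(z, w) \<in> s\<^sup>*" by (metis single_valuedD)
      then show ?thesis using w by blast
    next
      case False
      then have yz: "(y, z) \<in> t" using step by auto
      then have "y \<notin> Domain s" using disj by auto
      then have "y = w" using w(2) by (meson converse_rtranclE Domain.intros)
      with contract[OF yz] w(1) show ?thesis by (meson trancl_into_trancl)
    qed
  qed
  have bwd1: "(x, w) \<in> ?r\<^sup>+" if "(x, w) \<in> q" for x w
  proof -
    have "x \<in> ?D" using that dom by auto
    then obtain y where y: "(x, y) \<in> t" by auto
    then obtain w' where "(x, w') \<in> q" "(y, w') \<in> s\<^sup>*" using contract by blast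
    with that svq have "(y, w) \<in> s\<^sup>*" by (metis single_valuedD)
    then have "(y, w) \<in> ?r\<^sup>*" by (meson Un_upper1 rtrancl_mono subsetD)
    then show ?thesis using y by (meson UnI2 rtrancl_into_trancl2)
  qed
  have bwd: "(x, w) \<in> ?r\<^sup>+" if "(x, w) \<in> q\<^sup>+" for x w
    using that by (induction rule: trancl_induct) (meson bwd1 trancl_trans)+
  \<comment> \<open>A point \<open>y\<close> of \<open>Domain t\<close> has no outgoing
    \<open>s\<close>-edge, so the \<open>w\<close> supplied by \<open>fwd\<close> is
    \<open>y\<close> itself.\<close>
  have iff: "(x, y) \<in> ?r\<^sup>+ \<longleftrightarrow> (x, y) \<in> q\<^sup>+" if "x \<in> ?D" "y \<in> ?D" for x y
  proof
    assume "(x, y) \<in> ?r\<^sup>+"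
    then obtain w where w: "(x, w) \<in> q\<^sup>+" "(y, w) \<in> s\<^sup>*" using fwd \<open>x \<in> ?D\<close> by blast
    have "y \<notin> Domain s" using \<open>y \<in> ?D\<close> disj by auto
    then have "y = w" using w(2) by (meson converse_rtranclE Domain.intros)
    then show "(x, y) \<in> q\<^sup>+" using w by simp
  qed (rule bwd)
  let ?A = "{C \<in> cycles ?r. C \<inter> ?D = {}}" and ?B = "{C \<in> cycles ?r. C \<inter> ?D \<noteq> {}}"
  have finc: "finite (cycles ?r)"
    using cycles_subset_Domain[OF sv] fin by (meson finite_Pow_iff Pow_iff finite_subset subsetI)
  have s_le: "(x, y) \<in> s\<^sup>+ \<Longrightarrow> (x, y) \<in> ?r\<^sup>+" for x y
    by (erule trancl_mono) auto
  \<comment> \<open>A cycle avoiding \<open>Domain t\<close> can use only edges of \<open>s\<close>.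
    Conversely, a cycle of \<open>s\<close> stays in \<open>Domain s\<close>, where disjointness of
    the domains leaves no edge of \<open>t\<close> to follow.\<close>
  have A: "?A = cycles s"
  proof (intro Set.set_eqI iffI)
    fix C assume C: "C \<in> ?A"
    then obtain x where x: "C = ?r\<^sup>+ `` {x}" "(x, x) \<in> ?r\<^sup>+" by (auto simp: cycles_def)
    have "(x, y) \<in> s\<^sup>+" if "(x, y) \<in> ?r\<^sup>+" for y
      using that
    proof (induction rule: trancl_induct)
      case (base y)
      then show ?case using C x by auto
    next
      case (step y z)
      then have "y \<in> C" using x by auto
      then have "(y, z) \<in> s" using C step by auto
      then show ?case using step.IH by (meson trancl_into_trancl)
    qed
    then have "?r\<^sup>+ `` {x} = s\<^sup>+ `` {x}" "(x, x) \<in> s\<^sup>+" using s_le x by auto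
    then show "C \<in> cycles s" using x by (auto simp: cycles_def)
  next
    fix C assume C: "C \<in> cycles s"
    then obtain x where x: "C = s\<^sup>+ `` {x}" "(x, x) \<in> s\<^sup>+" by (auto simp: cycles_def)
    have sub: "C \<subseteq> Domain s" using cycles_subset_Domain[OF svs C] .
    have "(x, y) \<in> s\<^sup>+" if "(x, y) \<in> ?r\<^sup>+" for y
      using that
    proof (induction rule: trancl_induct)
      case (base y)
      then show ?case using sub disj x by auto
    next
      case (step y z)
      then have "y \<in> Domain s" using x sub by auto
      then have "(y, z) \<in> s" using disj step by auto
      then show ?case using step.IH by (meson trancl_into_trancl)
    qed
    then have "?r\<^sup>+ `` {x} = s\<^sup>+ `` {x}" using s_le by auto
    then have "C \<in> cycles ?r" unfolding cycles_def using x s_le by blast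
    then show "C \<in> ?A" using sub disj by auto
  qed
  have Int: "?r\<^sup>+ `` {x} \<inter> ?D = q\<^sup>+ `` {x}" if "x \<in> ?D" "(x, x) \<in> q\<^sup>+" for x
  proof -
    have "q\<^sup>+ `` {x} \<in> cycles q" using that(2) by (auto simp: cycles_def)
    then have "q\<^sup>+ `` {x} \<subseteq> ?D" using cycles_subset_Domain[OF svq] dom by auto
    then show ?thesis using iff that(1) by blast
  qed
  \<comment> \<open>A nonempty trace on \<open>Domain t\<close> determines the cycle, because a
    single common point does; \<open>Int\<close> identifies the traces as the cycles of
    \<open>q\<close>.\<close>
  have "bij_betw (\<lambda>C. C \<inter> ?D) ?B (cycles q)"
  proof (rule bij_betw_imageI)
    show "inj_on (\<lambda>C. C \<inter> ?D) ?B"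
    proof (rule inj_onI)
      fix C C' assume C: "C \<in> ?B" "C' \<in> ?B" and eq: "C \<inter> ?D = C' \<inter> ?D"
      then obtain x where "x \<in> C" "x \<in> C'" by blast
      then show "C = C'" using C cycles_eq_Image(1)[OF sv] by blast
    qed
    show "(\<lambda>C. C \<inter> ?D) ` ?B = cycles q"
    proof (intro Set.set_eqI iffI)
      fix K assume "K \<in> (\<lambda>C. C \<inter> ?D) ` ?B"
      then obtain C x where C: "C \<in> cycles ?r" "K = C \<inter> ?D" "x \<in> C" "x \<in> ?D" by blast
      then have "C = ?r\<^sup>+ `` {x}" "(x, x) \<in> q\<^sup>+"
        using cycles_eq_Image[OF sv C(1,3)] iff by auto
      then show "K \<in> cycles q" using C Int unfolding cycles_def by blast
    next
      fix K assume "K \<in> cycles q"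
      then obtain x where x: "K = q\<^sup>+ `` {x}" "(x, x) \<in> q\<^sup>+" by (auto simp: cycles_def)
      then have xD: "x \<in> ?D" using dom by (metis Domain.intros tranclD)
      have "?r\<^sup>+ `` {x} \<in> cycles ?r" using bwd x(2) unfolding cycles_def by blast
      moreover have "K = ?r\<^sup>+ `` {x} \<inter> ?D" using Int xD x by simp
      moreover have "x \<in> K" using x by simp
      ultimately show "K \<in> (\<lambda>C. C \<inter> ?D) ` ?B" by blast
    qed
  qed
  then have "card ?B = card (cycles q)" by (rule bij_betw_same_card)
  moreover have "card (cycles ?r) = card ?A + card ?B"
    using finc by (subst card_Un_disjoint[symmetric]) (auto intro!: arg_cong[of _ _ card])
  ultimately show ?thesis using A by simp
qed

section \<open>Cycle counts of maps, expressed through their graphs\<close>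

lemma Domain_graph [simp]: "Domain (graph S f) = S"
  by (auto simp: graph_def)

lemma graph_cong: "(\<And>i. i \<in> S \<Longrightarrow> f i = g i) \<Longrightarrow> graph S f = graph S g"
  by (auto simp: graph_def)

text \<open>Iterates of a periodic point repeat modulo the period, so finitely many of them exhaust
  the forward orbit. Conversely, a point that reaches itself in the graph has a positive return
  time.\<close>

lemma num_cycles_eq: "num_cycles S \<phi> = card (cycles (graph S \<phi>))"
proof -
  let ?r = "graph S \<phi>"
  have reach: "\<exists>i. y = (\<phi> ^^ i) x" if "(x, y) \<in> ?r\<^sup>+" for x y
    using that
  proof (induction rule: trancl_induct)
    case (base y)
    then show ?case by (auto simp: graph_def intro!: exI[of _ 1])
  next
    case (step y z)
    then obtain i where "y = (\<phi> ^^ i) x" "z = \<phi> y" by (auto simp: graph_def)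
    then show ?case by (auto intro!: exI[of _ "Suc i"])
  qed
  have iter: "(x, (\<phi> ^^ i) x) \<in> ?r\<^sup>*" if "\<And>l. l < i \<Longrightarrow> (\<phi> ^^ l) x \<in> S" for x i
    using that
  proof (induction i)
    case (Suc i)
    then have "(x, (\<phi> ^^ i) x) \<in> ?r\<^sup>*" "((\<phi> ^^ i) x, (\<phi> ^^ Suc i) x) \<in> ?r"
      by (auto simp: graph_def)
    then show ?case by (rule rtrancl_into_rtrancl)
  qed simp
  have "{C. C \<noteq> {} \<and> C \<subseteq> S \<and> (\<exists>j p. C = (\<lambda>i. (\<phi> ^^ i) j) ` {..<p} \<and> (\<phi> ^^ p) j = j)}
    = cycles ?r" (is "?L = _")
  proof (intro Set.set_eqI iffI)
    fix C assume "C \<in> ?L"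
    then obtain j p where C: "C \<noteq> {}" "C \<subseteq> S" "C = (\<lambda>i. (\<phi> ^^ i) j) ` {..<p}" "(\<phi> ^^ p) j = j"
      by blast
    \<comment> \<open>For \<open>p = 0\<close> the return condition holds trivially; only
      nonemptiness of \<open>C\<close> rules this case out.\<close>
    then have p: "p > 0" by auto
    have inC: "(\<phi> ^^ i) j \<in> C" for i
    proof -
      have "(\<phi> ^^ (i mod p)) j = (\<phi> ^^ i) j" by (rule funpow_mod_eq) (rule C(4))
      then show ?thesis using C(3) p by (metis imageI lessThan_iff mod_less_divisor)
    qed
    have plus: "(j, (\<phi> ^^ Suc i) j) \<in> ?r\<^sup>+" for i
    proof -
      have "(j, (\<phi> ^^ i) j) \<in> ?r\<^sup>*" using iter inC C(2) by blast
      moreover have "((\<phi> ^^ i) j, (\<phi> ^^ Suc i) j) \<in> ?r" using inC C(2) by (auto simp: graph_def)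
      ultimately show ?thesis by (rule rtrancl_into_trancl1)
    qed
    have jj: "(j, j) \<in> ?r\<^sup>+" using plus[of "p - 1"] p C(4) by simp
    have "(j, (\<phi> ^^ i) j) \<in> ?r\<^sup>+" for i
      using plus jj by (cases i) auto
    then have "C \<subseteq> ?r\<^sup>+ `` {j}" using C(3) by auto
    moreover have "?r\<^sup>+ `` {j} \<subseteq> C" using reach inC by blast
    ultimately show "C \<in> cycles ?r" unfolding cycles_def using jj by blast
  next
    fix C assume Cc: "C \<in> cycles ?r"
    then obtain x where x: "C = ?r\<^sup>+ `` {x}" "(x, x) \<in> ?r\<^sup>+" by (auto simp: cycles_def)
    have sub: "C \<subseteq> S" using cycles_subset_Domain[OF single_valued_graph Cc] by simp
    have inC: "(\<phi> ^^ i) x \<in> C" for i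
    proof (induction i)
      case 0
      then show ?case using x by simp
    next
      case (Suc i)
      then have "((\<phi> ^^ i) x, (\<phi> ^^ Suc i) x) \<in> ?r" using sub by (auto simp: graph_def)
      then show ?case using Suc x(1) by (auto intro: trancl_into_trancl)
    qed
    from x(2) obtain y where "(x, y) \<in> ?r" "(y, x) \<in> ?r\<^sup>*" by (meson tranclD)
    then have "y = \<phi> x" "y = x \<or> (y, x) \<in> ?r\<^sup>+" by (auto simp: graph_def rtrancl_eq_or_trancl)
    then have "\<exists>i. x = (\<phi> ^^ Suc i) x"
      using reach[of y x] by (metis funpow_0 funpow_Suc_right comp_apply)
    then obtain p where p: "p > 0" "(\<phi> ^^ p) x = x" by (metis zero_less_Suc)
    have "C \<subseteq> (\<lambda>i. (\<phi> ^^ i) x) ` {..<p}"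
    proof
      fix y assume "y \<in> C"
      then obtain i where "y = (\<phi> ^^ i) x" using x reach by blast
      then have "y = (\<phi> ^^ (i mod p)) x" using funpow_mod_eq[OF p(2)] by simp
      then show "y \<in> (\<lambda>i. (\<phi> ^^ i) x) ` {..<p}" using p(1) by auto
    qed
    then have "C = (\<lambda>i. (\<phi> ^^ i) x) ` {..<p}" using inC by auto
    then show "C \<in> ?L" using sub x p(2) by blast
  qed
  then show ?thesis by (simp add: num_cycles_def)
qed

text \<open>Where an edge leaving \<open>S\<close> points is irrelevant, since it lies on no cycle.
  This allows the labels of the columns outside the retained rows to be changed by
  re-indexing.\<close>

lemma num_cycles_cong_Int:
  assumes "\<And>i. i \<in> S \<Longrightarrow> \<phi> i = \<psi> i \<or> \<phi> i \<notin> S \<and> \<psi> i \<notin> S"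
  shows "num_cycles S \<phi> = num_cycles S \<psi>"
proof -
  have "graph S \<phi> \<inter> UNIV \<times> S = graph S \<psi> \<inter> UNIV \<times> S"
    using assms by (fastforce simp: graph_def)
  then show ?thesis
    using cycles_Int_Domain[OF single_valued_graph, of S \<phi>]
      cycles_Int_Domain[OF single_valued_graph, of S \<psi>] by (simp add: num_cycles_eq)
qed

text \<open>Here \<open>\<psi>\<close> is the contraction of \<open>\<phi>\<close> to
  \<open>T\<close>: it takes the \<open>\<phi>\<close>-edge out of a point of \<open>T\<close> and
  then follows \<open>\<phi>\<close> through \<open>S\<close> until it leaves
  \<open>S\<close>.\<close>

lemma num_cycles_contract:
  assumes "finite S" "finite T" "S \<inter> T = {}"
    and "\<And>i. i \<in> T \<Longrightarrow> \<psi> i \<notin> S \<and> (\<phi> i, \<psi> i) \<in> (graph S \<phi>)\<^sup>*"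
  shows "num_cycles (S \<union> T) \<phi> = num_cycles S \<phi> + num_cycles T \<psi>"
proof -
  have U: "graph (S \<union> T) \<phi> = graph S \<phi> \<union> graph T \<phi>" by (auto simp: graph_def)
  show ?thesis unfolding num_cycles_eq U
  proof (rule card_cycles_contract)
    show "single_valued (graph S \<phi> \<union> graph T \<phi>)" by (metis U single_valued_graph)
    fix x y assume "(x, y) \<in> graph T \<phi>"
    then show "\<exists>w. (x, w) \<in> graph T \<psi> \<and> (y, w) \<in> (graph S \<phi>)\<^sup>* \<and> w \<notin> Domain (graph S \<phi>)"
      using assms(4) by (auto simp: graph_def)
  qed (use assms in \<open>auto simp: single_valued_graph Domain_Un_eq\<close>)
qed

section \<open>The column map\<close>

text \<open>The original column that \<open>phi_bar S \<phi> [0..<n]\<close> stores under the label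
  \<open>j\<close>, for \<open>j\<close> outside \<open>S\<close>.\<close>

definition contract_col :: "nat set \<Rightarrow> (nat \<Rightarrow> nat) \<Rightarrow> nat \<Rightarrow> nat"
  where "contract_col S \<phi> j = (if j \<in> \<phi> ` S then phi_star S \<phi> j else j)"

lemma phi_star_props:
  assumes "finite S" "inj_on \<phi> S" "j \<in> \<phi> ` S - S"
  shows "phi_star S \<phi> j \<in> S - \<phi> ` S" and "(phi_star S \<phi> j, j) \<in> (graph S \<phi>)\<^sup>*"
proof -
  let ?g = "inv_into S \<phi>"
  have ex: "\<exists>l. (?g ^^ l) j \<in> S - \<phi> ` S"
  proof (rule ccontr)
    assume none: "\<nexists>l. (?g ^^ l) j \<in> S - \<phi> ` S"
    have img: "(?g ^^ l) j \<in> \<phi> ` S" for l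
    proof (induction l)
      case 0
      then show ?case using assms(3) by simp
    next
      case (Suc l)
      then have "(?g ^^ Suc l) j \<in> S" by (simp add: inv_into_into)
      then show ?case using none by blast
    qed
    have inS: "(?g ^^ Suc l) j \<in> S" for l using img[of l] by (simp add: inv_into_into)
    have unwind: "(\<phi> ^^ l) ((?g ^^ (l + i)) j) = (?g ^^ i) j" for l i
    proof (induction l)
      case (Suc l)
      have "\<phi> ((?g ^^ (Suc l + i)) j) = (?g ^^ (l + i)) j"
        using img[of "l + i"] by (simp add: f_inv_into_f)
      then show ?case using Suc by (metis comp_apply funpow_Suc_right)
    qed simp
    have "range (\<lambda>l. (?g ^^ l) j) \<subseteq> \<phi> ` S" using img by auto
    then have "finite (range (\<lambda>l. (?g ^^ l) j))" using assms(1) finite_subset by blast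
    then have "\<not> inj (\<lambda>l. (?g ^^ l) j)" using finite_imageD infinite_UNIV_nat by blast
    then obtain a b where ab: "a < b" "(?g ^^ a) j = (?g ^^ b) j"
      unfolding inj_def by (metis nat_neq_iff)
    \<comment> \<open>Apply \<open>\<phi>\<close> to both equal terms \<open>a\<close>
      times.\<close>
    then have "j = (?g ^^ (b - a)) j" using unwind[of a 0] unwind[of a "b - a"] by simp
    moreover have "(?g ^^ (b - a)) j \<in> S"
      using inS[of "b - a - 1"] ab(1) by (simp add: Suc_diff_Suc del: funpow.simps)
    ultimately show False using assms(3) by simp
  qed
  define L where "L = (LEAST l. (?g ^^ l) j \<in> S - \<phi> ` S)"
  have star: "phi_star S \<phi> j = (?g ^^ L) j" by (simp add: phi_star_def L_def)
  show "phi_star S \<phi> j \<in> S - \<phi> ` S"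
    unfolding star L_def using ex by (rule LeastI_ex)
  have img: "(?g ^^ l) j \<in> \<phi> ` S" if "l < L" for l
    using that
  proof (induction l)
    case 0
    then show ?case using assms(3) by simp
  next
    case (Suc l)
    then have "(?g ^^ l) j \<in> \<phi> ` S" by simp
    then have "(?g ^^ Suc l) j \<in> S" by (simp add: inv_into_into)
    then show ?case using not_less_Least Suc.prems unfolding L_def by blast
  qed
  have "((?g ^^ l) j, j) \<in> (graph S \<phi>)\<^sup>*" if "l \<le> L" for l
    using that
  proof (induction l)
    case (Suc l)
    then have "(?g ^^ l) j \<in> \<phi> ` S" using img by simp
    then have "((?g ^^ Suc l) j, (?g ^^ l) j) \<in> graph S \<phi>"
      by (auto simp: graph_def image_iff f_inv_into_f inv_into_into)
    then show ?case using Suc by (meson Suc_leD converse_rtrancl_into_rtrancl)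
  qed simp
  then show "(phi_star S \<phi> j, j) \<in> (graph S \<phi>)\<^sup>*" by (simp add: star)
qed

lemma contract_col_reaches:
  assumes "finite S" "inj_on \<phi> S" "j \<notin> S"
  shows "(contract_col S \<phi> j, j) \<in> (graph S \<phi>)\<^sup>*"
  using phi_star_props[OF assms(1,2)] assms(3) by (auto simp: contract_col_def)

text \<open>If two labels have the same image, both are reached from it along the one forced path,
  so one reaches the other; no edge leaves a label outside \<open>S\<close>, so they are equal.
  Surjectivity follows by counting, as \<open>\<phi>\<close> preserves the size of
  \<open>S\<close>.\<close>

lemma bij_betw_contract_col:
  assumes "finite N" "S \<subseteq> N" "\<phi> \<in> Inj S N"
  shows "bij_betw (contract_col S \<phi>) (N - S) (N - \<phi> ` S)"
proof -
  have fin: "finite S" using assms finite_subset by blast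
  have \<phi>: "inj_on \<phi> S" "\<phi> ` S \<subseteq> N" using assms(3) by (auto simp: Inj_def)
  have inj: "inj_on (contract_col S \<phi>) (N - S)"
  proof (rule inj_onI)
    fix j j' assume j: "j \<in> N - S" "j' \<in> N - S" and eq: "contract_col S \<phi> j = contract_col S \<phi> j'"
    have "(contract_col S \<phi> j, j) \<in> (graph S \<phi>)\<^sup>*" "(contract_col S \<phi> j, j') \<in> (graph S \<phi>)\<^sup>*"
      using contract_col_reaches[OF fin \<phi>(1), of j] contract_col_reaches[OF fin \<phi>(1), of j'] j eq
      by auto
    then have "(j, j') \<in> (graph S \<phi>)\<^sup>* \<or> (j', j) \<in> (graph S \<phi>)\<^sup>*"
      by (rule single_valued_confluent[OF single_valued_graph])
    then show "j = j'" using j by (auto elim!: converse_rtranclE simp: graph_def)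
  qed
  have "contract_col S \<phi> ` (N - S) \<subseteq> N - \<phi> ` S"
    using phi_star_props(1)[OF fin \<phi>(1)] assms(2) by (auto simp: contract_col_def)
  moreover have "card (contract_col S \<phi> ` (N - S)) = card (N - \<phi> ` S)"
    using assms fin \<phi> inj by (simp add: card_image card_Diff_subset)
  ultimately have "contract_col S \<phi> ` (N - S) = N - \<phi> ` S"
    using assms(1) by (intro card_subset_eq) auto
  then show ?thesis using inj by (simp add: bij_betw_def)
qed

lemma phi_bar_upt:
  assumes "S \<subseteq> {..<n}" "\<phi> \<in> Inj S {..<n}"
  shows "phi_bar S \<phi> [0..<n] = map (contract_col S \<phi>) (sorted_list_of_set ({..<n} - S))"
proof -
  have "finite S" using assms(1) finite_subset by blast
  moreover have "inj_on \<phi> S" using assms(2) by (simp add: Inj_def)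
  \<comment> \<open>The bound makes looking up \<open>phi_star S \<phi> j\<close> in
    \<open>[0..<n]\<close> return that same number.\<close>
  ultimately have "phi_star S \<phi> j < n" if "j \<in> \<phi> ` S" "j \<notin> S" for j
    using phi_star_props(1) that assms(1) by blast
  then show ?thesis by (auto simp: phi_bar_def contract_col_def)
qed

section \<open>Sums over partial injections\<close>

lemma finite_Inj: "finite S \<Longrightarrow> finite N \<Longrightarrow> finite (Inj S N)"
  unfolding Inj_def by (rule finite_subset[OF _ finite_PiE[of S "\<lambda>_. N"]]) auto

text \<open>The map \<open>d\<close> decodes labels into actual columns. The value
  \<open>undefined\<close> off \<open>S \<union> T\<close> is the one that the extensional function
  space in \<open>Inj\<close> demands.\<close>

definition Inj_join ::
    "nat set \<Rightarrow> nat set \<Rightarrow> (nat \<Rightarrow> nat) \<Rightarrow> (nat \<Rightarrow> nat) \<Rightarrow> (nat \<Rightarrow> nat) \<Rightarrow> nat \<Rightarrow> nat"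
  where "Inj_join S T d \<phi> \<psi> i = (if i \<in> S then \<phi> i else if i \<in> T then d (\<psi> i) else undefined)"

text \<open>An injection on \<open>S \<union> T\<close> amounts to an injection
  \<open>\<phi>\<close> on \<open>S\<close> and an injection of \<open>T\<close> into the columns
  that \<open>\<phi>\<close> leaves free. The bijection \<open>d \<phi>\<close> names these columns
  by the elements of \<open>Q \<phi>\<close>.\<close>

lemma sum_Inj_Un:
  assumes fin: "finite S" "finite T" "finite N" and disj: "S \<inter> T = {}"
    and bij: "\<And>\<phi>. \<phi> \<in> Inj S N \<Longrightarrow> bij_betw (d \<phi>) (Q \<phi>) (N - \<phi> ` S)"
  shows "sum f (Inj (S \<union> T) N) = (\<Sum>\<phi>\<in>Inj S N. \<Sum>\<psi>\<in>Inj T (Q \<phi>). f (Inj_join S T (d \<phi>) \<phi> \<psi>))"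
proof -
  have finQ: "finite (Q \<phi>)" if "\<phi> \<in> Inj S N" for \<phi>
    using bij[OF that] fin(3) by (metis bij_betw_finite finite_Diff)
  let ?h = "\<lambda>(\<phi>, \<psi>). Inj_join S T (d \<phi>) \<phi> \<psi>"
  \<comment> \<open>The inverse of \<open>?h\<close>: restrict to \<open>S\<close>, and on
    \<open>T\<close> recover the labels by inverting the decoding that belongs to this
    restriction.\<close>
  let ?g = "\<lambda>\<Phi>. (restrict \<Phi> S, restrict (\<lambda>i. inv_into (Q (restrict \<Phi> S)) (d (restrict \<Phi> S)) (\<Phi> i)) T)"
  have "(\<Sum>\<phi>\<in>Inj S N. \<Sum>\<psi>\<in>Inj T (Q \<phi>). f (Inj_join S T (d \<phi>) \<phi> \<psi>))
    = (\<Sum>p\<in>(SIGMA \<phi>:Inj S N. Inj T (Q \<phi>)). f (?h p))"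
    using fin finQ by (subst sum.Sigma) (auto simp: finite_Inj case_prod_unfold)
  also have "\<dots> = sum f (Inj (S \<union> T) N)"
  proof (rule sum.reindex_bij_witness[where i = ?g and j = ?h])
    fix p assume "p \<in> (SIGMA \<phi>:Inj S N. Inj T (Q \<phi>))"
    then obtain \<phi> \<psi> where p: "p = (\<phi>, \<psi>)" and \<phi>: "\<phi> \<in> Inj S N" and \<psi>: "\<psi> \<in> Inj T (Q \<phi>)" by auto
    let ?\<Phi> = "Inj_join S T (d \<phi>) \<phi> \<psi>"
    have d: "inj_on (d \<phi>) (Q \<phi>)" "d \<phi> ` Q \<phi> = N - \<phi> ` S" using bij[OF \<phi>] by (auto simp: bij_betw_def)
    have \<psi>Q: "\<psi> i \<in> Q \<phi>" if "i \<in> T" for i using \<psi> that by (auto simp: Inj_def)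
    have dN: "d \<phi> (\<psi> i) \<in> N - \<phi> ` S" if "i \<in> T" for i using \<psi>Q[OF that] d(2) by blast
    have S: "restrict ?\<Phi> S = \<phi>"
      using \<phi> by (auto simp: Inj_join_def Inj_def PiE_def extensional_def fun_eq_iff)
    have "restrict (\<lambda>i. inv_into (Q \<phi>) (d \<phi>) (?\<Phi> i)) T = \<psi>"
      using \<psi> disj d(1) \<psi>Q
      by (auto simp: Inj_join_def Inj_def PiE_def extensional_def fun_eq_iff)
    then show "?g (?h p) = p" using S by (simp add: p)
    have "inj_on ?\<Phi> S" using \<phi> by (auto simp: Inj_join_def Inj_def inj_on_def)
    moreover have "inj_on ?\<Phi> T"
    proof (rule inj_onI)
      fix a b assume ab: "a \<in> T" "b \<in> T" "?\<Phi> a = ?\<Phi> b"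
      then have "d \<phi> (\<psi> a) = d \<phi> (\<psi> b)" using disj by (auto simp: Inj_join_def split: if_splits)
      then have "\<psi> a = \<psi> b" using d(1) \<psi>Q ab by (meson inj_onD)
      then show "a = b" using \<psi> ab by (auto simp: Inj_def dest: inj_onD)
    qed
    moreover have "?\<Phi> ` S = \<phi> ` S" "?\<Phi> ` T \<subseteq> N - \<phi> ` S"
      using dN disj by (auto simp: Inj_join_def)
    ultimately have "inj_on ?\<Phi> (S \<union> T)" by (auto simp: inj_on_Un)
    moreover have "?\<Phi> \<in> (S \<union> T) \<rightarrow>\<^sub>E N" using dN \<phi> by (auto simp: Inj_join_def Inj_def)
    ultimately show "?h p \<in> Inj (S \<union> T) N" by (simp add: p Inj_def)
  next
    fix \<Phi> assume \<Phi>: "\<Phi> \<in> Inj (S \<union> T) N"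
    let ?\<phi> = "restrict \<Phi> S"
    have \<phi>: "?\<phi> \<in> Inj S N" using \<Phi> by (auto simp: Inj_def inj_on_def)
    have d: "inj_on (d ?\<phi>) (Q ?\<phi>)" "d ?\<phi> ` Q ?\<phi> = N - \<Phi> ` S" using bij[OF \<phi>] by (auto simp: bij_betw_def)
    have im: "\<Phi> i \<in> d ?\<phi> ` Q ?\<phi>" if "i \<in> T" for i
      unfolding d(2) using \<Phi> that disj by (auto simp: Inj_def dest: inj_onD)
    show "?h (?g \<Phi>) = \<Phi>"
      using \<Phi> disj im by (auto simp: Inj_join_def Inj_def PiE_def extensional_def fun_eq_iff f_inv_into_f)
    have "inj_on (\<lambda>i. inv_into (Q ?\<phi>) (d ?\<phi>) (\<Phi> i)) T"
    proof (rule inj_onI)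
      fix a b assume ab: "a \<in> T" "b \<in> T"
        "inv_into (Q ?\<phi>) (d ?\<phi>) (\<Phi> a) = inv_into (Q ?\<phi>) (d ?\<phi>) (\<Phi> b)"
      then have "\<Phi> a = \<Phi> b" using im by (metis inv_into_injective)
      then show "a = b" using \<Phi> ab by (auto simp: Inj_def dest: inj_onD)
    qed
    then have "restrict (\<lambda>i. inv_into (Q ?\<phi>) (d ?\<phi>) (\<Phi> i)) T \<in> Inj T (Q ?\<phi>)"
      using im by (auto simp: Inj_def inv_into_into inj_on_def)
    then show "?g \<Phi> \<in> (SIGMA \<phi>:Inj S N. Inj T (Q \<phi>))" using \<phi> by simp
  qed simp
  finally show ?thesis by simp
qed

lemma sum_subsets_Un:
  assumes "X \<inter> Y = {}"
  shows "(\<Sum>U\<in>Pow (X \<union> Y). f U) = (\<Sum>S\<in>Pow X. \<Sum>T\<in>Pow Y. f (S \<union> T))"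
proof -
  have "(\<Sum>S\<in>Pow X. \<Sum>T\<in>Pow Y. f (S \<union> T)) = (\<Sum>p\<in>Pow X \<times> Pow Y. f (fst p \<union> snd p))"
    by (simp add: sum.cartesian_product case_prod_unfold)
  also have "\<dots> = (\<Sum>U\<in>Pow (X \<union> Y). f U)"
    by (rule sum.reindex_bij_witness[where i = "\<lambda>U. (U \<inter> X, U \<inter> Y)" and j = "\<lambda>p. fst p \<union> snd p"])
      (use assms in auto)
  finally show ?thesis by simp
qed

section \<open>Expansion of the rook polynomial and splitting of its rows\<close>

lemma monom_sum: "monom (sum f S) l = (\<Sum>i\<in>S. monom (f i) l)"
  by (induction S rule: infinite_finite_induct) (auto simp: add_monom[symmetric])

text \<open>Summing over all row sets at once, not size by size, lets a row set be split in two
  without tracking cardinalities.\<close>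

lemma cyclic_rook_poly_alt:
  "cyclic_rook_poly A = (\<Sum>U\<in>Pow {..<dim_row A}. \<Sum>\<phi>\<in>Inj U {..<dim_col A}.
     monom (monom (\<Prod>i\<in>U. A $$ (i, \<phi> i)) (num_cycles U \<phi>)) (card U))" (is "_ = sum ?g _")
proof -
  let ?m = "dim_row A"
  have "cyclic_rook_poly A = (\<Sum>l\<le>?m. \<Sum>S | S \<in> Pow {..<?m} \<and> card S = l. ?g S)"
    unfolding cyclic_rook_poly_def cyclic_rook_number_def monom_sum
    by (intro sum.cong) auto
  also have "\<dots> = sum ?g (Pow {..<?m})"
    by (rule sum.group) (auto intro: card_mono[of "{..<?m}", simplified])
  finally show ?thesis .
qed

text \<open>All deleted indices are at least \<open>k\<close>, so the first \<open>k\<close> columns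
  keep their positions and re-indexing does not disturb cycles among the retained rows.\<close>

lemma sorted_list_of_set_Diff_split:
  assumes "k \<le> n" "S \<subseteq> {k..<n}"
  shows "sorted_list_of_set ({..<n} - S) = [0..<k] @ sorted_list_of_set ({k..<n} - S)"
proof -
  have "{..<n} - S = set ([0..<k] @ sorted_list_of_set ({k..<n} - S))" using assms by auto
  moreover have "sorted ([0..<k] @ sorted_list_of_set ({k..<n} - S))"
    by (auto simp: sorted_append)
  moreover have "distinct ([0..<k] @ sorted_list_of_set ({k..<n} - S))" by auto
  ultimately show ?thesis by (metis sorted_list_of_set.idem_if_sorted_distinct)
qed

text \<open>The expansion for one fixed pair of row sets. Entries and cardinalities split along
  \<open>S\<close> and \<open>T\<close>, and cycle counts add by contraction, so each summand is a
  product.\<close>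

lemma sum_Inj_split_rows:
  fixes A :: "'a::comm_ring_1 mat"
  assumes r: "r \<le> n" and S: "S \<subseteq> {r..<n}" and T: "T \<subseteq> {..<r}"
  shows "(\<Sum>\<phi>\<in>Inj (S \<union> T) {..<n}.
       monom (monom (\<Prod>i\<in>S \<union> T. A $$ (i, \<phi> i)) (num_cycles (S \<union> T) \<phi>)) (card (S \<union> T)))
    = (\<Sum>\<phi>\<in>Inj S {..<n}. monom (monom (\<Prod>i\<in>S. A $$ (i, \<phi> i)) (num_cycles S \<phi>)) (card S) *
       (\<Sum>\<psi>\<in>Inj T {..<n - card S}.
         monom (monom (\<Prod>i\<in>T. rows_cols A {..<r} (phi_bar S \<phi> [0..<n]) $$ (i, \<psi> i))
           (num_cycles T \<psi>)) (card T)))"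
proof -
  \<comment> \<open>\<open>?e\<close> turns a position in the reduced matrix into its label outside
    \<open>S\<close>; \<open>?d\<close> turns it into the original column stored there.\<close>
  let ?e = "\<lambda>q. sorted_list_of_set ({..<n} - S) ! q"
  let ?d = "\<lambda>\<phi> q. contract_col S \<phi> (?e q)"
  have Sn: "S \<subseteq> {..<n}" using S by auto
  have fin: "finite S" "finite T" using S T finite_subset by blast+
  have disj: "S \<inter> T = {}"
    using S T by (meson atLeastLessThan_iff disjoint_iff lessThan_iff not_less subsetD)
  have len: "length (sorted_list_of_set ({..<n} - S)) = n - card S"
    using Sn fin by (simp add: card_Diff_subset)
  have e: "bij_betw ?e {..<n - card S} ({..<n} - S)"
    using bij_betw_nth[of "sorted_list_of_set ({..<n} - S)" "{..<n - card S}"] len by simp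
  have e_lt: "?e q = q" if "q < r" for q
    using sorted_list_of_set_Diff_split[OF r S] that by (simp add: nth_append)
  \<comment> \<open>The positions below \<open>r\<close> already use up all labels below
    \<open>r\<close>, so injectivity of \<open>?e\<close> leaves only larger labels for the
    others.\<close>
  have e_ge: "?e q \<ge> r" if "q \<ge> r" "q < n - card S" for q
  proof (rule ccontr)
    assume "\<not> ?e q \<ge> r"
    then have "?e (?e q) = ?e q" "?e q < r" using e_lt by auto
    moreover have "?e q \<in> {..<n - card S}" using calculation(2) that by simp
    ultimately have "?e q = q"
      using bij_betw_imp_inj_on[OF e] that(2) by (meson inj_onD lessThan_iff)
    then show False using \<open>?e q < r\<close> that(1) by simp
  qed
  have bij: "bij_betw (?d \<phi>) {..<n - card S} ({..<n} - \<phi> ` S)" if "\<phi> \<in> Inj S {..<n}" for \<phi>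
    using bij_betw_trans[OF e bij_betw_contract_col[OF _ Sn that]] by (simp add: comp_def)
  have split: "monom (monom (\<Prod>i\<in>S \<union> T. A $$ (i, \<Phi> i)) (num_cycles (S \<union> T) \<Phi>)) (card (S \<union> T))
    = monom (monom (\<Prod>i\<in>S. A $$ (i, \<phi> i)) (num_cycles S \<phi>)) (card S) *
      monom (monom (\<Prod>i\<in>T. rows_cols A {..<r} (phi_bar S \<phi> [0..<n]) $$ (i, \<psi> i))
        (num_cycles T \<psi>)) (card T)"
    if \<phi>: "\<phi> \<in> Inj S {..<n}" and \<psi>: "\<psi> \<in> Inj T {..<n - card S}"
      and \<Phi>: "\<Phi> = Inj_join S T (?d \<phi>) \<phi> \<psi>" for \<phi> \<psi> \<Phi>
  proof -
    have \<phi>S: "\<Phi> i = \<phi> i" if "i \<in> S" for i using that by (simp add: \<Phi> Inj_join_def)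
    have \<phi>T: "\<Phi> i = ?d \<phi> (\<psi> i)" if "i \<in> T" for i using that disj by (auto simp: \<Phi> Inj_join_def)
    have \<psi>n: "\<psi> i < n - card S" if "i \<in> T" for i using \<psi> that by (auto simp: Inj_def)
    have gr: "graph S \<Phi> = graph S \<phi>" using \<phi>S by (rule graph_cong)
    \<comment> \<open>From the column \<open>\<Phi> i\<close> with \<open>i \<in> T\<close>, the map
      \<open>\<phi>\<close> leads back to the label \<open>?e (\<psi> i)\<close>, so this label is
      the contracted value.\<close>
    have "num_cycles (S \<union> T) \<Phi> = num_cycles S \<Phi> + num_cycles T (\<lambda>i. ?e (\<psi> i))"
    proof (rule num_cycles_contract[OF fin disj])
      fix i assume i: "i \<in> T"
      have "?e (\<psi> i) \<in> {..<n} - S" using e \<psi>n[OF i] by (meson bij_betwE lessThan_iff)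
      moreover have "inj_on \<phi> S" using \<phi> by (simp add: Inj_def)
      ultimately show "?e (\<psi> i) \<notin> S \<and> (\<Phi> i, ?e (\<psi> i)) \<in> (graph S \<Phi>)\<^sup>*"
        using contract_col_reaches[OF fin(1)] by (auto simp: \<phi>T[OF i] gr)
    qed
    also have "num_cycles S \<Phi> = num_cycles S \<phi>" by (simp add: num_cycles_eq gr)
    \<comment> \<open>Labels become positions: below \<open>r\<close> they agree, and from
      \<open>r\<close> on both lie outside \<open>T\<close>.\<close>
    also have "num_cycles T (\<lambda>i. ?e (\<psi> i)) = num_cycles T \<psi>"
    proof (rule num_cycles_cong_Int)
      fix i assume i: "i \<in> T"
      show "?e (\<psi> i) = \<psi> i \<or> ?e (\<psi> i) \<notin> T \<and> \<psi> i \<notin> T"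
        using e_lt[of "\<psi> i"] e_ge[of "\<psi> i"] \<psi>n[OF i] T by (cases "\<psi> i < r") auto
    qed
    finally have cyc: "num_cycles (S \<union> T) \<Phi> = num_cycles S \<phi> + num_cycles T \<psi>" .
    have entry: "rows_cols A {..<r} (phi_bar S \<phi> [0..<n]) $$ (i, \<psi> i) = A $$ (i, \<Phi> i)"
      if i: "i \<in> T" for i
    proof -
      have "sorted_list_of_set {..<r} ! i = i"
        using i T by (auto simp: lessThan_atLeast0)
      then show ?thesis
        using i T \<psi>n[OF i] len by (auto simp: rows_cols_def phi_bar_upt[OF Sn \<phi>] \<phi>T)
    qed
    have "(\<Prod>i\<in>S \<union> T. A $$ (i, \<Phi> i))
      = (\<Prod>i\<in>S. A $$ (i, \<phi> i)) * (\<Prod>i\<in>T. rows_cols A {..<r} (phi_bar S \<phi> [0..<n]) $$ (i, \<psi> i))"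
      using fin disj by (simp add: prod.union_disjoint \<phi>S entry)
    then show ?thesis
      using fin disj by (simp add: cyc card_Un_disjoint mult_monom)
  qed
  show ?thesis
    \<comment> \<open>The label set is the same for every \<open>\<phi>\<close>, because the number
      of free columns depends only on \<open>card S\<close>.\<close>
    by (subst sum_Inj_Un[where d = ?d and Q = "\<lambda>_. {..<n - card S}"])
      (use fin disj bij split in \<open>auto simp: sum_distrib_left intro!: sum.cong\<close>)
qed

theorem theorem2:
  fixes A :: "'a::comm_ring_1 mat" and m n k :: nat
  assumes "A \<in> carrier_mat m n" and "m \<le> n" and "1 \<le> k" and "k \<le> m - 1"
  shows "cyclic_rook_poly A =
    (\<Sum>S | S \<subseteq> {..<m} - {..<m - k} \<and> S \<noteq> {}. \<Sum>\<phi>\<in>Inj S {..<n}.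
       monom (monom (\<Prod>i\<in>S. A $$ (i, \<phi> i)) (num_cycles S \<phi>)) (card S) *
       cyclic_rook_poly (rows_cols A {..<m - k} (phi_bar S \<phi> [0..<n])))
    + cyclic_rook_poly (rows_cols A {..<m - k} [0..<n])"
proof -
  let ?r = "m - k" and ?X = "{..<m} - {..<m - k}"
  let ?B = "\<lambda>S \<phi>. rows_cols A {..<m - k} (phi_bar S \<phi> [0..<n])"
  let ?t = "\<lambda>U \<phi>. monom (monom (\<Prod>i\<in>U. A $$ (i, \<phi> i)) (num_cycles U \<phi>)) (card U)"
  let ?g = "\<lambda>S. \<Sum>\<phi>\<in>Inj S {..<n}. ?t S \<phi> * cyclic_rook_poly (?B S \<phi>)"
  have dims: "dim_row A = m" "dim_col A = n" using assms(1) by auto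
  have rows: "(\<Sum>T\<in>Pow {..<?r}. \<Sum>\<phi>\<in>Inj (S \<union> T) {..<n}. ?t (S \<union> T) \<phi>) = ?g S" if S: "S \<in> Pow ?X" for S
  proof -
    have Sn: "S \<subseteq> {..<n}" using S assms(2) by auto
    have dimB: "dim_row (?B S \<phi>) = ?r" "dim_col (?B S \<phi>) = n - card S" if "\<phi> \<in> Inj S {..<n}" for \<phi>
      using Sn that finite_subset[OF Sn]
      by (auto simp: rows_cols_def phi_bar_upt card_Diff_subset)
    have "(\<Sum>T\<in>Pow {..<?r}. \<Sum>\<phi>\<in>Inj (S \<union> T) {..<n}. ?t (S \<union> T) \<phi>)
      = (\<Sum>T\<in>Pow {..<?r}. \<Sum>\<phi>\<in>Inj S {..<n}. ?t S \<phi> * (\<Sum>\<psi>\<in>Inj T {..<n - card S}.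
          monom (monom (\<Prod>i\<in>T. ?B S \<phi> $$ (i, \<psi> i)) (num_cycles T \<psi>)) (card T)))"
    proof (rule sum.cong[OF refl])
      fix T assume "T \<in> Pow {..<?r}"
      moreover have "?r \<le> n" "S \<subseteq> {?r..<n}" using S assms(2) by auto
      ultimately show "(\<Sum>\<phi>\<in>Inj (S \<union> T) {..<n}. ?t (S \<union> T) \<phi>)
        = (\<Sum>\<phi>\<in>Inj S {..<n}. ?t S \<phi> * (\<Sum>\<psi>\<in>Inj T {..<n - card S}.
            monom (monom (\<Prod>i\<in>T. ?B S \<phi> $$ (i, \<psi> i)) (num_cycles T \<psi>)) (card T)))"
        by (intro sum_Inj_split_rows) auto
    qed
    also have "\<dots> = ?g S"
      \<comment> \<open>Once \<open>\<phi>\<close> is chosen before \<open>T\<close>, the inner sum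
        over \<open>T\<close> is the rook polynomial of the reduced matrix.\<close>
      by (subst sum.swap) (auto simp: cyclic_rook_poly_alt dimB sum_distrib_left intro!: sum.cong)
    finally show ?thesis .
  qed
  have "{..<m} = ?X \<union> {..<?r}" by auto
  then have "cyclic_rook_poly A = (\<Sum>U\<in>Pow (?X \<union> {..<?r}). \<Sum>\<phi>\<in>Inj U {..<n}. ?t U \<phi>)"
    by (simp only: cyclic_rook_poly_alt dims)
  also have "\<dots> = (\<Sum>S\<in>Pow ?X. \<Sum>T\<in>Pow {..<?r}. \<Sum>\<phi>\<in>Inj (S \<union> T) {..<n}. ?t (S \<union> T) \<phi>)"
    by (rule sum_subsets_Un) auto
  also have "\<dots> = sum ?g (Pow ?X)"
    by (rule sum.cong) (auto simp only: rows)
  also have "\<dots> = sum ?g (Pow ?X - {{}}) + ?g {}"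
    by (subst sum.remove[of _ "{}"]) auto
  also have "Pow ?X - {{}} = {S. S \<subseteq> ?X \<and> S \<noteq> {}}" by auto
  \<comment> \<open>The empty row set carries one map, with no cycles and weight 1, and leaves the
    list of columns unchanged.\<close>
  also have "?g {} = cyclic_rook_poly (rows_cols A {..<?r} [0..<n])"
  proof -
    have "Inj {} {..<n} = {\<lambda>_. undefined}" by (auto simp: Inj_def)
    moreover have "phi_bar {} (\<lambda>_. undefined) [0..<n] = [0..<n]"
      using map_nth[of "[0..<n]"] by (simp add: phi_bar_def lessThan_atLeast0)
    moreover have "num_cycles {} (\<lambda>_. undefined) = 0" by (auto simp: num_cycles_def)
    ultimately show ?thesis by (simp add: monom_0 flip: one_pCons)
  qed
  finally show ?thesis .
qed

end
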